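(* Suppose the inverse robust optimization problem $(\mathcal{P}_{\mathrm{IROP}})$ has a maximizer $(x^*,W^* )\in X\times\mathcal{W}$, that $f(x^*,\cdot)$ and $g(x^*,\cdot)$ are convex functions on $\mathrm{conv}(\mathcal{U})$, that the merit function $V:\mathcal{W}\to\mathbb{R}$ satisfies (B1) the restriction of $V$ to $\mathcal{K}(\mathcal{U})\cap\mathcal{W}$ is upper semi-continuous with respect to the topology induced by the Hausdorff metric, and (B2) $V(W_1)\le V(W_2)$ for all $W_1,W_2\in\mathcal{W}$ with $W_1\subseteq W_2$, and that the cover space satisfies $\tilde W^*:=\mathrm{conv}(W^* )\cap\mathcal{U}\in\mathcal{W}$. Then $(x^*,\tilde W^* )$ is also a maximizer of $(\mathcal{P}_{\mathrm{IROP}})$.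
   Context: Here $X\subseteq\mathbb{R}^n$, $\mathcal{U}\subseteq\mathbb{R}^m$ is the uncertainty set, $\mathcal{W}\subseteq 2^{\mathcal{U}}$ is the cover space, and $f,g$ are real-valued functions of $(x,u)$ with $x\in X$, $u\in\mathbb{R}^m$, such that $f(\cdot,u)$ and $g(\cdot,u)$ are continuous on $X$ for each fixed $u$. A nominal scenario $\bar u\in\mathcal{U}$ is fixed, and it is assumed that the nominal problem $f^*:=\min\{f(x,\bar u): x\in X,\ g(x,\bar u)\le 0\}$ has a feasible point and that $f^*$ is well defined. A budget $\epsilon\ge 0$ is fixed. The inverse robust optimization problem $(\mathcal{P}_{\mathrm{IROP}})$ is: maximize $V(W)$ over all $(x,W)\in X\times\mathcal{W}$ subject to $f(x,u)\le f^*+\epsilon$ for all $u\in W$, $\ g(x,u)\le 0$ for all $u\in W$, and $\bar u\in W$. A maximizer is a feasible pair attaining the maximal value of $V(W)$ among feasible pairs. $\mathrm{conv}$ denotes the convex hull, and $\mathcal{K}(\mathcal{U})$ denotes the set of all compact subsets of $\mathcal{U}$, with the Hausdorff metric (if the empty set is included it is treated as an isolated point). *)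

theory Defs
  imports "HOL-Analysis.Analysis"
begin

section \<open>Hausdorff metric topology on the compact subsets of a set\<close>

text \<open>
  The value is the usual one for nonempty bounded sets. In all other cases the suprema are
  unspecified reals, so the distance is set to 0 there; no such case is used below.
\<close>
definition hausdorff_dist :: "'a::metric_space set \<Rightarrow> 'a set \<Rightarrow> real" where
  "hausdorff_dist A B =
    (if A \<noteq> {} \<and> B \<noteq> {} \<and> bounded A \<and> bounded B
     then max (SUP a\<in>A. infdist a B) (SUP b\<in>B. infdist b A) else 0)"

definition compact_subsets :: "'a::metric_space set \<Rightarrow> 'a set set" where
  "compact_subsets U = {K. K \<subseteq> U \<and> compact K}"

text \<open>
  The metric topology on the nonempty compact subsets of \<open>U\<close>, with the empty set adjoined as an
  isolated point. (No real-valued convention for the distance to the empty set is needed.)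
\<close>
definition hausdorff_topology :: "'a::metric_space set \<Rightarrow> 'a set topology" where
  "hausdorff_topology U = topology (\<lambda>S. S \<subseteq> compact_subsets U \<and>
     openin (Metric_space.mtopology (compact_subsets U - {{}}) hausdorff_dist) (S - {{}}))"

lemma hausdorff_dist_commute: "hausdorff_dist A B = hausdorff_dist B A"
  by (auto simp: hausdorff_dist_def max.commute)

lemma bdd_above_infdist_image:
  fixes A B :: "'a::metric_space set"
  assumes "bounded A"
  shows "bdd_above ((\<lambda>a. infdist a B) ` A)"
proof (cases "B = {}")
  case True
  then show ?thesis by (auto simp: infdist_def)
next
  case False
  then obtain b where b: "b \<in> B" by auto
  obtain e where e: "\<And>a. a \<in> A \<Longrightarrow> dist b a \<le> e"
    using assms bounded_any_center[of A b] by auto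
  show ?thesis
    by (rule bdd_aboveI2[of _ _ e]) (metis b dist_commute e infdist_le order_trans)
qed

lemma infdist_le_hausdorff_dist:
  fixes A B :: "'a::metric_space set"
  assumes "A \<noteq> {}" "B \<noteq> {}" "bounded A" "bounded B" "a \<in> A"
  shows "infdist a B \<le> hausdorff_dist A B"
  using cSUP_upper[OF assms(5) bdd_above_infdist_image[OF assms(3), of B]] assms
  by (simp add: hausdorff_dist_def)

lemma hausdorff_dist_le:
  fixes A B :: "'a::metric_space set"
  assumes "A \<noteq> {}" "B \<noteq> {}" "bounded A" "bounded B"
    and "\<And>a. a \<in> A \<Longrightarrow> infdist a B \<le> e" and "\<And>b. b \<in> B \<Longrightarrow> infdist b A \<le> e"
  shows "hausdorff_dist A B \<le> e"
  using assms by (auto simp: hausdorff_dist_def intro!: cSUP_least)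

lemma hausdorff_dist_nonneg: "0 \<le> hausdorff_dist A B"
proof (cases "A \<noteq> {} \<and> B \<noteq> {} \<and> bounded A \<and> bounded B")
  case True
  then obtain a where "a \<in> A" by auto
  with True show ?thesis
    using infdist_le_hausdorff_dist[of A B a] infdist_nonneg[of a B] by linarith
next
  case False
  then show ?thesis unfolding hausdorff_dist_def by auto
qed

lemma infdist_triangle_sets:
  fixes A B C :: "'a::metric_space set"
  assumes "A \<noteq> {}" "compact B" "B \<noteq> {}" "bounded A" "compact C" "C \<noteq> {}" "a \<in> A"
  shows "infdist a C \<le> hausdorff_dist A B + hausdorff_dist B C"
proof -
  obtain b where b: "b \<in> B" "\<And>y. y \<in> B \<Longrightarrow> dist a b \<le> dist a y"
    using continuous_attains_inf[of B "\<lambda>y. dist a y"] assms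
      continuous_on_dist[OF continuous_on_const[of B a] continuous_on_id] by auto
  then have "dist a b \<le> infdist a B"
    using assms by (auto simp: infdist_notempty intro!: cINF_greatest)
  have "infdist a C \<le> infdist b C + dist a b"
    by (rule infdist_triangle)
  also have "\<dots> \<le> hausdorff_dist B C + hausdorff_dist A B"
    using infdist_le_hausdorff_dist[of B C b] infdist_le_hausdorff_dist[of A B a] b assms
      \<open>dist a b \<le> infdist a B\<close> by (simp add: compact_imp_bounded)
  finally show ?thesis by simp
qed

lemma Metric_space_hausdorff_dist:
  "Metric_space (compact_subsets U - {{}}) hausdorff_dist"
proof
  show "0 \<le> hausdorff_dist A B" for A B :: "'a set"
    by (rule hausdorff_dist_nonneg)
  show "hausdorff_dist A B = hausdorff_dist B A" for A B :: "'a set"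
    by (rule hausdorff_dist_commute)
next
  fix A B assume AB: "A \<in> compact_subsets U - {{}}" "B \<in> compact_subsets U - {{}}"
  have sub: "A' \<subseteq> B'"
    if "hausdorff_dist A' B' = 0" "compact A'" "compact B'" "A' \<noteq> {}" "B' \<noteq> {}" for A' B' :: "'a set"
  proof
    fix a assume "a \<in> A'"
    then have "infdist a B' = 0"
      using infdist_le_hausdorff_dist[of A' B' a] infdist_nonneg[of a B'] that
      by (simp add: compact_imp_bounded)
    then show "a \<in> B'"
      using in_closed_iff_infdist_zero[of B' a] that compact_imp_closed by blast
  qed
  show "(hausdorff_dist A B = 0) = (A = B)"
  proof
    assume "hausdorff_dist A B = 0"
    with sub[of A B] sub[of B A] AB show "A = B"
      by (auto simp: compact_subsets_def hausdorff_dist_commute)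
  next
    assume "A = B"
    with AB show "hausdorff_dist A B = 0"
      by (intro antisym hausdorff_dist_nonneg hausdorff_dist_le)
        (auto simp: compact_subsets_def compact_imp_bounded)
  qed
next
  fix A B C
  assume *: "A \<in> compact_subsets U - {{}}" "B \<in> compact_subsets U - {{}}" "C \<in> compact_subsets U - {{}}"
  have 1: "infdist a C \<le> hausdorff_dist A B + hausdorff_dist B C" if "a \<in> A" for a
    using infdist_triangle_sets[of A B C a] * that by (auto simp: compact_subsets_def compact_imp_bounded)
  have 2: "infdist c A \<le> hausdorff_dist A B + hausdorff_dist B C" if "c \<in> C" for c
    using infdist_triangle_sets[of C B A c] * that
    by (auto simp: compact_subsets_def compact_imp_bounded hausdorff_dist_commute)
  show "hausdorff_dist A C \<le> hausdorff_dist A B + hausdorff_dist B C"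
    using * 1 2 by (intro hausdorff_dist_le) (auto simp: compact_subsets_def compact_imp_bounded)
qed

lemma openin_hausdorff_topology:
  "openin (hausdorff_topology U) S \<longleftrightarrow> S \<subseteq> compact_subsets U \<and>
     openin (Metric_space.mtopology (compact_subsets U - {{}}) hausdorff_dist) (S - {{}})"
proof -
  have "istopology (\<lambda>S. S \<subseteq> compact_subsets U \<and>
     openin (Metric_space.mtopology (compact_subsets U - {{}}) hausdorff_dist) (S - {{}}))"
    unfolding istopology_def
  proof (rule conjI, clarify)
    fix S T :: "'a set set"
    assume "openin (Metric_space.mtopology (compact_subsets U - {{}}) hausdorff_dist) (S - {{}})"
      and "openin (Metric_space.mtopology (compact_subsets U - {{}}) hausdorff_dist) (T - {{}})"
      and "S \<subseteq> compact_subsets U"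
    moreover have "S \<inter> T - {{}} = (S - {{}}) \<inter> (T - {{}})" by auto
    ultimately show "S \<inter> T \<subseteq> compact_subsets U \<and>
      openin (Metric_space.mtopology (compact_subsets U - {{}}) hausdorff_dist) (S \<inter> T - {{}})"
      by auto
  next
    show "\<forall>\<K>. (\<forall>K\<in>\<K>. K \<subseteq> compact_subsets U \<and>
        openin (Metric_space.mtopology (compact_subsets U - {{}}) hausdorff_dist) (K - {{}})) \<longrightarrow>
      \<Union>\<K> \<subseteq> compact_subsets U \<and>
        openin (Metric_space.mtopology (compact_subsets U - {{}}) hausdorff_dist) (\<Union>\<K> - {{}})"
    proof (intro allI impI conjI)
      fix \<K> :: "'a set set set"
      assume K: "\<forall>K\<in>\<K>. K \<subseteq> compact_subsets U \<and>
        openin (Metric_space.mtopology (compact_subsets U - {{}}) hausdorff_dist) (K - {{}})"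
      then show "\<Union>\<K> \<subseteq> compact_subsets U" by blast
      have "\<Union>\<K> - {{}} = (\<Union>K\<in>\<K>. K - {{}})" by auto
      then show "openin (Metric_space.mtopology (compact_subsets U - {{}}) hausdorff_dist) (\<Union>\<K> - {{}})"
        using K by (metis (no_types, lifting) imageE openin_Union)
    qed
  qed
  then show ?thesis by (simp add: hausdorff_topology_def)
qed

lemma topspace_hausdorff_topology: "topspace (hausdorff_topology U) = compact_subsets U"
proof -
  interpret Metric_space "compact_subsets U - {{}}" hausdorff_dist
    by (rule Metric_space_hausdorff_dist)
  have "openin (hausdorff_topology U) (compact_subsets U)"
    using open_in_mspace by (simp add: openin_hausdorff_topology)
  then show ?thesis
    by (metis openin_hausdorff_topology openin_subset openin_topspace subset_antisym)
qed

lemma openin_hausdorff_topology_empty_set: "openin (hausdorff_topology U) {{}}"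
  by (simp add: openin_hausdorff_topology compact_subsets_def)

definition upper_semicontinuous_map :: "'a topology \<Rightarrow> ('a \<Rightarrow> real) \<Rightarrow> bool" where
  "upper_semicontinuous_map T h \<longleftrightarrow> (\<forall>c. openin T {x \<in> topspace T. h x < c})"

section \<open>The inverse robust optimization problem\<close>

definition nominal_feasible ::
  "('x \<Rightarrow> 'u \<Rightarrow> real) \<Rightarrow> 'x set \<Rightarrow> 'u \<Rightarrow> 'x set" where
  "nominal_feasible g X ubar = {x \<in> X. g x ubar \<le> 0}"

text \<open>The minimal value \<open>f\<^sup>*\<close>; meaningful only if the minimum is attained.\<close>
definition nominal_value ::
  "('x \<Rightarrow> 'u \<Rightarrow> real) \<Rightarrow> ('x \<Rightarrow> 'u \<Rightarrow> real) \<Rightarrow> 'x set \<Rightarrow> 'u \<Rightarrow> real" where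
  "nominal_value f g X ubar = (LEAST v. v \<in> (\<lambda>x. f x ubar) ` nominal_feasible g X ubar)"

definition irop_feasible ::
  "('x \<Rightarrow> 'u \<Rightarrow> real) \<Rightarrow> ('x \<Rightarrow> 'u \<Rightarrow> real) \<Rightarrow> 'x set \<Rightarrow> 'u set set \<Rightarrow> 'u \<Rightarrow> real
    \<Rightarrow> 'x \<times> 'u set \<Rightarrow> bool" where
  "irop_feasible f g X \<W> ubar \<epsilon> = (\<lambda>(x, W). x \<in> X \<and> W \<in> \<W> \<and>
     (\<forall>u\<in>W. f x u \<le> nominal_value f g X ubar + \<epsilon>) \<and> (\<forall>u\<in>W. g x u \<le> 0) \<and> ubar \<in> W)"

definition irop_maximizer ::
  "('x \<Rightarrow> 'u \<Rightarrow> real) \<Rightarrow> ('x \<Rightarrow> 'u \<Rightarrow> real) \<Rightarrow> 'x set \<Rightarrow> 'u set set \<Rightarrow> 'u \<Rightarrow> real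
    \<Rightarrow> ('u set \<Rightarrow> real) \<Rightarrow> 'x \<times> 'u set \<Rightarrow> bool" where
  "irop_maximizer f g X \<W> ubar \<epsilon> V =
     is_arg_max (\<lambda>(x, W). V W) (irop_feasible f g X \<W> ubar \<epsilon>)"

end

theory Submission
  imports Defs
begin

text \<open>Sublevel sets of a convex function are convex, so an upper bound that
  \<open>f xs\<close> or \<open>g xs\<close> satisfies on \<open>Ws\<close> persists on
  \<open>convex hull Ws\<close>. This is \<open>convex_on_le_convex_hull\<close>; it makes the
  enlarged pair feasible for the same \<open>xs\<close>. Enlarging \<open>Ws\<close> cannot lower
  \<open>V\<close> by \<open>B2\<close>, so the optimal value is still attained.\<close>

text \<open>Two sets appear because convexity is given on the hull of all scenarios
  (\<open>S\<close> is \<U>), while the bound is known only on the chosen cover (\<open>T\<close> is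
  \<open>Ws\<close>).\<close>

lemma convex_on_le_convex_hull:
  fixes h :: "'a::real_vector \<Rightarrow> real"
  assumes "convex_on (convex hull S) h" "T \<subseteq> S" "\<And>u. u \<in> T \<Longrightarrow> h u \<le> c" "u \<in> convex hull T"
  shows "h u \<le> c"
proof -
  have "convex_on (convex hull T) h"
    using assms(1) hull_mono[OF assms(2)] convex_convex_hull by (rule convex_on_subset)
  then show ?thesis
    using convex_on_convex_hull_bound assms(3,4) by blast
qed

theorem lemma2p5:
  fixes X :: "(real ^ 'n) set"
    and \<U> :: "(real ^ 'm) set"
    and \<W> :: "(real ^ 'm) set set"
    and f g :: "real ^ 'n \<Rightarrow> real ^ 'm \<Rightarrow> real"
    and ubar :: "real ^ 'm"
    and \<epsilon> :: real
    and V :: "(real ^ 'm) set \<Rightarrow> real"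
    and xs :: "real ^ 'n"
    and Ws :: "(real ^ 'm) set"
  assumes "\<W> \<subseteq> Pow \<U>"
    and "\<And>u. continuous_on X (\<lambda>x. f x u)"
    and "\<And>u. continuous_on X (\<lambda>x. g x u)"
    and "ubar \<in> \<U>"
    and "nominal_feasible g X ubar \<noteq> {}"
    and "\<exists>x. is_arg_min (\<lambda>x. f x ubar) (\<lambda>x. x \<in> nominal_feasible g X ubar) x"
    and "\<epsilon> \<ge> 0"
    and "irop_maximizer f g X \<W> ubar \<epsilon> V (xs, Ws)"
    and "convex_on (convex hull \<U>) (\<lambda>u. f xs u)"
    and "convex_on (convex hull \<U>) (\<lambda>u. g xs u)"
    and B1: "upper_semicontinuous_map (subtopology (hausdorff_topology \<U>) \<W>) V"
    and B2: "\<And>W1 W2. W1 \<in> \<W> \<Longrightarrow> W2 \<in> \<W> \<Longrightarrow> W1 \<subseteq> W2 \<Longrightarrow> V W1 \<le> V W2"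
    and "convex hull Ws \<inter> \<U> \<in> \<W>"
  shows "irop_maximizer f g X \<W> ubar \<epsilon> V (xs, convex hull Ws \<inter> \<U>)"
proof -
  let ?W = "convex hull Ws \<inter> \<U>"
  have feas: "irop_feasible f g X \<W> ubar \<epsilon> (xs, Ws)"
    and max: "\<And>p. irop_feasible f g X \<W> ubar \<epsilon> p \<Longrightarrow> \<not> V (snd p) > V Ws"
    using assms(8) by (auto simp: irop_maximizer_def is_arg_max_def)
  have "Ws \<in> \<W>"
    using feas by (simp add: irop_feasible_def)
  then have "Ws \<subseteq> \<U>"
    using assms(1) by blast
  \<comment> \<open>Since \<open>Ws\<close> lies in \<U>, cutting the hull back to \<U> loses no
    point of \<open>Ws\<close>. This inclusion serves twice: for the monotonicity of
    \<open>V\<close> and for keeping \<open>ubar\<close> in the cover.\<close>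
  then have "Ws \<subseteq> ?W"
    by (simp add: hull_subset)
  then have "V Ws \<le> V ?W"
    using B2 \<open>Ws \<in> \<W>\<close> assms(13) by blast
  have "irop_feasible f g X \<W> ubar \<epsilon> (xs, ?W)"
    using feas assms(13) \<open>Ws \<subseteq> ?W\<close>
      convex_on_le_convex_hull[OF assms(9) \<open>Ws \<subseteq> \<U>\<close>]
      convex_on_le_convex_hull[OF assms(10) \<open>Ws \<subseteq> \<U>\<close>]
    unfolding irop_feasible_def by blast
  \<comment> \<open>A feasible pair with value above \<open>V ?W\<close> would also beat
    \<open>V Ws\<close>, contradicting \<open>max\<close>.\<close>
  with max \<open>V Ws \<le> V ?W\<close> show ?thesis
    unfolding irop_maximizer_def is_arg_max_def by fastforce
qed

end
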